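(* Let $\mathcal{R}$ be a good base of size $m$ (over $n$-bit strings) and let $d=\frac{n}{4\log m}-1$. Then $$\Pr_{r\leftarrow\mathcal{R}}\Big[\forall \varepsilon<\tfrac12,\ \forall p:\{0,1\}^m\to\mathbb{R} \text{ with } \deg(p)\le d,\ \exists y\in D_r:\ |p(y)-\mathsf{PUR}_r(y)|>\varepsilon\Big]\ge\frac23,$$ where $r$ is drawn uniformly at random from $\mathcal{R}$.
   Context: For $\tau\in\{0,1\}^n$ let $\mathcal{R}^\tau=\{v\in\{0,1\}^n: v_k=0 \text{ for every } k \text{ with } \tau_k=0\}$ (bits where $\tau_k=1$ are free). Let $\mathbf{1}_j\in\{0,1\}^n$ be the string with a 1 in position $j$ and 0 elsewhere. A good base of size $m=n+m'$ is a set of the form $\mathcal{R}=\{\mathbf{1}_1\}\times\cdots\times\{\mathbf{1}_n\}\times\mathcal{R}^{\tau^{(1)}}\times\cdots\times\mathcal{R}^{\tau^{(m')}}$ for some templates $\tau^{(1)},\dots,\tau^{(m')}\in\{0,1\}^n$; an element is an $m$-tuple $r=(r_1,\dots,r_m)$ of $n$-bit strings, and sampling $r$ uniformly from $\mathcal{R}$ means each $r_{n+j}$ is uniform on $\mathcal{R}^{\tau^{(j)}}$, independently. For $r\in\mathcal{R}$ and $x\in\{0,1\}^n$, $\mathcal{Y}(r,x)\in\{0,1\}^m$ is given by $\mathcal{Y}(r,x)_j=\langle r_j,x\rangle \bmod 2$. For fixed $r$, let $D_r=\{\mathcal{Y}(r,x): x\in\{0,1\}^n\}$ and let $\mathsf{PUR}_r:D_r\to\{0,1\}$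 be $\mathsf{PUR}_r(\mathcal{Y}(r,x))=\mathsf{parity}(x)=x_1\oplus\cdots\oplus x_n$ (well defined since the first $n$ coordinates of $\mathcal{Y}(r,x)$ equal $x$). Logarithms are base 2. *)

theory Defs
  imports "HOL-Probability.Probability_Mass_Function"
begin

text \<open>Bit strings are lists of Booleans; positions are numbered from 0.\<close>

definition bits :: "nat \<Rightarrow> bool list set" where
  "bits n = {v. length v = n}"

definition template_set :: "bool list \<Rightarrow> bool list set" where
  "template_set \<tau> = {v \<in> bits (length \<tau>). \<forall>k<length \<tau>. \<not> \<tau> ! k \<longrightarrow> \<not> v ! k}"

definition unit_string :: "nat \<Rightarrow> nat \<Rightarrow> bool list" where
  "unit_string n j = map (\<lambda>k. k = j) [0..<n]"

text \<open>The library function \<^const>\<open>listset\<close> is the Cartesian product of a list of sets.\<close>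

definition good_base :: "nat \<Rightarrow> nat \<Rightarrow> bool list list set \<Rightarrow> bool" where
  "good_base n m R \<longleftrightarrow> (\<exists>\<tau>s. set \<tau>s \<subseteq> bits n \<and> m = n + length \<tau>s \<and>
     R = listset (map (\<lambda>j. {unit_string n j}) [0..<n] @ map template_set \<tau>s))"

definition inner2 :: "bool list \<Rightarrow> bool list \<Rightarrow> bool" where
  "inner2 v x \<longleftrightarrow> odd (\<Sum>k<length x. of_bool (v ! k) * of_bool (x ! k) :: nat)"

definition parity :: "bool list \<Rightarrow> bool" where
  "parity x \<longleftrightarrow> odd (\<Sum>k<length x. of_bool (x ! k) :: nat)"

definition Y_string :: "bool list list \<Rightarrow> bool list \<Rightarrow> bool list" where
  "Y_string r x = map (\<lambda>v. inner2 v x) r"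

definition D_set :: "nat \<Rightarrow> bool list list \<Rightarrow> bool list set" where
  "D_set n r = Y_string r ` bits n"

text \<open>Only meaningful for arguments in \<^term>\<open>D_set n r\<close>, with \<^term>\<open>r\<close> in a good base;
  see \<open>PUR_Y_string\<close> below.\<close>

definition PUR :: "nat \<Rightarrow> bool list list \<Rightarrow> bool list \<Rightarrow> bool" where
  "PUR n r y = parity (THE x. x \<in> bits n \<and> Y_string r x = y)"

text \<open>A real multilinear polynomial in \<open>m\<close> variables is given by its coefficients, indexed by
  the sets of variables occurring in the monomials.\<close>

definition multilinear :: "nat \<Rightarrow> (nat set \<Rightarrow> real) \<Rightarrow> bool list \<Rightarrow> real" where
  "multilinear m c y = (\<Sum>S\<in>Pow {..<m}. c S * (\<Prod>i\<in>S. of_bool (y ! i)))"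

text \<open>The degree of a function on the cube is the degree of the multilinear polynomial
  representing it; that polynomial exists and is unique, see \<open>multilinear_exists\<close> and
  \<open>multilinear_unique\<close>. The zero function has degree 0, as for \<open>degree\<close> of univariate
  polynomials. Values of \<^term>\<open>p\<close> outside \<^term>\<open>bits m\<close> are ignored.\<close>

definition cube_degree :: "nat \<Rightarrow> (bool list \<Rightarrow> real) \<Rightarrow> nat" where
  "cube_degree m p = (LEAST k. \<exists>c. (\<forall>y\<in>bits m. p y = multilinear m c y) \<and>
     (\<forall>S\<in>Pow {..<m}. c S \<noteq> 0 \<longrightarrow> card S \<le> k))"

lemma multilinear_indicator:
  assumes "T \<subseteq> {..<m}"
  shows "multilinear m c (map (\<lambda>i. i \<in> T) [0..<m]) = (\<Sum>S\<in>Pow T. c S)"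
proof -
  have "(\<Prod>i\<in>S. of_bool (map (\<lambda>i. i \<in> T) [0..<m] ! i)) = (of_bool (S \<subseteq> T) :: real)"
    if "S \<subseteq> {..<m}" for S
  proof -
    have "finite S" using that finite_subset by blast
    have "(\<Prod>i\<in>S. of_bool (map (\<lambda>i. i \<in> T) [0..<m] ! i)) = (\<Prod>i\<in>S. of_bool (i \<in> T) :: real)"
      using that by (intro prod.cong) auto
    also have "\<dots> = of_bool (S \<subseteq> T)"
      using \<open>finite S\<close> by induction auto
    finally show ?thesis .
  qed
  hence "multilinear m c (map (\<lambda>i. i \<in> T) [0..<m]) = (\<Sum>S\<in>Pow {..<m}. c S * of_bool (S \<subseteq> T))"
    unfolding multilinear_def by (intro sum.cong) auto
  also have "\<dots> = (\<Sum>S\<in>Pow T. c S)"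
    using assms by (intro sum.mono_neutral_cong_right) auto
  finally show ?thesis .
qed

lemma bits_indicator:
  assumes "y \<in> bits m"
  obtains T where "T \<subseteq> {..<m}" "y = map (\<lambda>i. i \<in> T) [0..<m]"
proof
  show "{i. i < m \<and> y ! i} \<subseteq> {..<m}" by auto
  show "y = map (\<lambda>i. i \<in> {i. i < m \<and> y ! i}) [0..<m]"
    using assms by (intro nth_equalityI) (auto simp: bits_def)
qed

lemma subset_sums_exist:
  "\<exists>c :: nat set \<Rightarrow> real. \<forall>T\<subseteq>{..<m}. f T = (\<Sum>S\<in>Pow T. c S)"
proof (induction m arbitrary: f)
  case 0
  show ?case by (intro exI[of _ f]) auto
next
  case (Suc m)
  obtain c0 where c0: "\<And>T. T \<subseteq> {..<m} \<Longrightarrow> f T = (\<Sum>S\<in>Pow T. c0 S)"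
    using Suc.IH[of f] by blast
  obtain c1 where c1: "\<And>T. T \<subseteq> {..<m} \<Longrightarrow> f (insert m T) - f T = (\<Sum>S\<in>Pow T. c1 S)"
    using Suc.IH[of "\<lambda>T. f (insert m T) - f T"] by blast
  define c where "c S = (if m \<in> S then c1 (S - {m}) else c0 S)" for S
  have low: "(\<Sum>S\<in>Pow T. c S) = f T" if "T \<subseteq> {..<m}" for T
    unfolding c0[OF that] by (intro sum.cong) (use that in \<open>auto simp: c_def\<close>)
  have "f T = (\<Sum>S\<in>Pow T. c S)" if T: "T \<subseteq> {..<Suc m}" for T
  proof (cases "m \<in> T")
    case False
    hence "T \<subseteq> {..<m}" using T by (auto simp: lessThan_Suc)
    thus ?thesis using low by simp
  next
    case True
    define U where "U = T - {m}"
    have U: "U \<subseteq> {..<m}" "m \<notin> U" "T = insert m U" "finite U"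
      using T True by (auto simp: U_def lessThan_Suc intro: finite_subset)
    have "(\<Sum>S\<in>Pow T. c S) = (\<Sum>S\<in>Pow U. c S) + (\<Sum>S\<in>insert m ` Pow U. c S)"
      unfolding U(3) Pow_insert using U by (intro sum.union_disjoint) auto
    also have "(\<Sum>S\<in>insert m ` Pow U. c S) = (\<Sum>S\<in>Pow U. c (insert m S))"
      by (subst sum.reindex) (use U(2) in \<open>auto simp: inj_on_def\<close>)
    also have "\<dots> = (\<Sum>S\<in>Pow U. c1 S)"
      using U(2) by (intro sum.cong) (auto simp: c_def intro!: arg_cong[of _ _ c1])
    also have "\<dots> = f T - f U" using c1[OF U(1)] U(3) by simp
    finally show ?thesis using low[OF U(1)] by simp
  qed
  thus ?case by blast
qed

lemma multilinear_exists: "\<exists>c. \<forall>y\<in>bits m. p y = multilinear m c y"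
proof -
  obtain c where c: "\<And>T. T \<subseteq> {..<m} \<Longrightarrow> p (map (\<lambda>i. i \<in> T) [0..<m]) = (\<Sum>S\<in>Pow T. c S)"
    using subset_sums_exist[of m "\<lambda>T. p (map (\<lambda>i. i \<in> T) [0..<m])"] by blast
  have "p y = multilinear m c y" if "y \<in> bits m" for y
    using that by (elim bits_indicator) (simp add: multilinear_indicator c)
  thus ?thesis by blast
qed

lemma multilinear_unique:
  assumes eq: "\<forall>y\<in>bits m. multilinear m c y = multilinear m c' y" and "T \<subseteq> {..<m}"
  shows "c T = c' T"
proof -
  have "finite T" using assms(2) finite_subset by blast
  thus ?thesis using assms(2)
  proof (induction T rule: finite_psubset_induct)
    case (psubset T)
    have "(\<Sum>S\<in>Pow T. c S) = (\<Sum>S\<in>Pow T. c' S)"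
      using eq psubset.prems by (simp flip: multilinear_indicator add: bits_def)
    moreover have "(\<Sum>S\<in>Pow T - {T}. c S) = (\<Sum>S\<in>Pow T - {T}. c' S)"
      using psubset by (intro sum.cong) auto
    ultimately show ?case
      using psubset.hyps by (simp add: sum.remove[of "Pow T" T])
  qed
qed

lemma in_listset_iff: "xs \<in> listset As \<longleftrightarrow> list_all2 (\<in>) xs As"
  by (induction As arbitrary: xs) (auto simp: set_Cons_def list_all2_Cons2)

lemma inner2_unit_string:
  assumes "x \<in> bits n" "j < n"
  shows "inner2 (unit_string n j) x = x ! j"
proof -
  have "(\<Sum>k<length x. of_bool (unit_string n j ! k) * of_bool (x ! k)) =
      (\<Sum>k<n. if k = j then of_bool (x ! k) else (0::nat))"
    using assms by (intro sum.cong) (auto simp: bits_def unit_string_def)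
  thus ?thesis using assms by (simp add: inner2_def)
qed

lemma take_Y_string:
  assumes "good_base n m R" "r \<in> R" "x \<in> bits n"
  shows "take n (Y_string r x) = x"
proof -
  obtain \<tau>s where "list_all2 (\<in>) r
      (map (\<lambda>j. {unit_string n j}) [0..<n] @ map template_set \<tau>s)"
    using assms by (auto simp: good_base_def in_listset_iff)
  hence r: "length r = n + length \<tau>s" "\<And>j. j < n + length \<tau>s \<Longrightarrow>
      r ! j \<in> (map (\<lambda>j. {unit_string n j}) [0..<n] @ map template_set \<tau>s) ! j"
    by (auto simp: list_all2_conv_all_nth)
  have "length r \<ge> n" using r(1) by simp
  moreover have "r ! j = unit_string n j" if "j < n" for j
    using r(2)[of j] that by (simp add: nth_append)
  ultimately show ?thesis using assms(3)
    by (intro nth_equalityI) (auto simp: Y_string_def bits_def inner2_unit_string)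
qed

lemma PUR_Y_string:
  assumes "good_base n m R" "r \<in> R" "x \<in> bits n"
  shows "PUR n r (Y_string r x) = parity x"
proof -
  have "(THE x'. x' \<in> bits n \<and> Y_string r x' = Y_string r x) = x"
    using assms(3) take_Y_string[OF assms(1,2)] by (intro the_equality) metis+
  thus ?thesis by (simp add: PUR_def)
qed

lemma good_base_finite:
  assumes "good_base n m R"
  shows "finite R" "R \<noteq> {}"
proof -
  obtain \<tau>s where R: "R = listset (map (\<lambda>j. {unit_string n j}) [0..<n] @ map template_set \<tau>s)"
    using assms by (auto simp: good_base_def)
  have "finite (bits k)" for k
    using finite_lists_length_eq[of "UNIV :: bool set" k] by (simp add: bits_def)
  hence ft: "finite (template_set \<tau>)" for \<tau> by (simp add: template_set_def)
  have nt: "\<tau> \<in> template_set \<tau>" for \<tau> by (simp add: template_set_def bits_def)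
  have fin: "finite (listset As)" if "\<forall>A\<in>set As. finite A" for As :: "bool list set list"
    using that
  proof (induction As)
    case (Cons A As)
    have "set_Cons A (listset As) = (\<lambda>(x, xs). x # xs) ` (A \<times> listset As)"
      by (auto simp: set_Cons_def)
    thus ?case using Cons by simp
  qed simp
  have ne: "listset As \<noteq> {}" if "\<forall>A\<in>set As. A \<noteq> {}" for As :: "bool list set list"
    using that by (induction As) (auto simp: set_Cons_def)
  show "finite R"
    unfolding R by (intro fin) (auto simp: ft)
  have "template_set \<tau> \<noteq> {}" for \<tau> using nt by blast
  thus "R \<noteq> {}"
    unfolding R by (intro ne) auto
qed

end

theory Submission
  imports Defs
begin

text \<open>A monomial of degree at most \<open>k\<close> in the bits of \<open>Y_string r x\<close> is a linear combination of
  characters of \<open>x\<close>, each given by the sum modulo 2 of at most \<open>k\<close> of the strings in \<open>r\<close>. Such a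
  character is orthogonal to the parity of \<open>x\<close> unless that sum is the all-ones string. Hence, if
  no set of at most \<open>k\<close> strings of \<open>r\<close> adds up to the all-ones string, a polynomial of degree at most
  \<open>k\<close> is uncorrelated with the parity and cannot be within \<open>\<epsilon> < 1/2\<close> of it everywhere. For a fixed set
  \<open>S\<close> of rows, the strings add up to the all-ones string with probability at most \<open>2 ^ card S / 2 ^ n\<close>:
  at a position outside of \<open>S\<close> the unit strings contribute nothing, so the sum there is 0 or a
  uniformly random bit, independently over these positions. A union bound over the sets \<open>S\<close> with at
  most \<open>k\<close> elements finishes.\<close>

definition bit_sign :: "bool \<Rightarrow> real" where
  "bit_sign b = (if b then -1 else 1)"

definition row_sum :: "nat set \<Rightarrow> bool list list \<Rightarrow> nat \<Rightarrow> bool" where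
  "row_sum S r k \<longleftrightarrow> odd (\<Sum>j\<in>S. of_bool (r ! j ! k) :: nat)"

definition sums_to_ones :: "nat \<Rightarrow> nat set \<Rightarrow> bool list list \<Rightarrow> bool" where
  "sums_to_ones n S r \<longleftrightarrow> (\<forall>k<n. row_sum S r k)"

definition ones_sum_of_at_most :: "nat \<Rightarrow> nat \<Rightarrow> bool list list \<Rightarrow> bool" where
  "ones_sum_of_at_most k n r \<longleftrightarrow> (\<exists>S\<subseteq>{..<length r}. card S \<le> k \<and> sums_to_ones n S r)"


subsection \<open>Signs and characters\<close>

lemma bit_sign_xor: "bit_sign (a \<noteq> b) = bit_sign a * bit_sign b"
  by (auto simp: bit_sign_def)

lemma bit_sign_eq_iff [simp]: "bit_sign a = bit_sign b \<longleftrightarrow> a = b"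
  by (auto simp: bit_sign_def)

lemma bit_sign_odd_sum:
  "bit_sign (odd (\<Sum>k\<in>A. of_bool (P k) :: nat)) = (\<Prod>k\<in>A. bit_sign (P k))"
  by (induction A rule: infinite_finite_induct) (auto simp: bit_sign_def)

lemma bit_sign_parity: "bit_sign (parity x) = (\<Prod>k<length x. bit_sign (x ! k))"
  unfolding parity_def by (rule bit_sign_odd_sum)

lemma bit_sign_inner2: "bit_sign (inner2 v x) = (\<Prod>k<length x. bit_sign (v ! k \<and> x ! k))"
  unfolding inner2_def by (simp flip: of_bool_conj bit_sign_odd_sum)

lemma bit_sign_row_sum: "bit_sign (row_sum S r k) = (\<Prod>j\<in>S. bit_sign (r ! j ! k))"
  unfolding row_sum_def by (rule bit_sign_odd_sum)

lemma prod_of_bool_eq_sum_bit_signs: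
  assumes "finite S"
  shows "(\<Prod>i\<in>S. of_bool (P i) :: real) =
    (\<Sum>T\<in>Pow S. (-1) ^ card T / 2 ^ card S * (\<Prod>i\<in>T. bit_sign (P i)))"
proof -
  have "(\<Prod>i\<in>S. of_bool (P i) :: real) = (\<Prod>i\<in>S. (- bit_sign (P i) + 1) / 2)"
    by (intro prod.cong) (auto simp: bit_sign_def)
  also have "\<dots> = (\<Sum>T\<in>Pow S. (\<Prod>i\<in>T. - bit_sign (P i)) * (\<Prod>i\<in>S - T. 1)) / 2 ^ card S"
    by (simp only: prod_dividef prod_add[OF assms] prod_constant)
  also have "\<dots> = (\<Sum>T\<in>Pow S. (-1) ^ card T / 2 ^ card S * (\<Prod>i\<in>T. bit_sign (P i)))"
    by (simp add: prod_uminus sum_divide_distrib)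
  finally show ?thesis .
qed

lemma bits_0: "bits 0 = {[]}"
  by (auto simp: bits_def)

lemma bits_Suc: "bits (Suc n) = (\<lambda>(b, x). b # x) ` (UNIV \<times> bits n)"
  by (auto simp: bits_def length_Suc_conv image_iff)

lemma finite_bits: "finite (bits n)"
  by (induction n) (auto simp: bits_0 bits_Suc)

lemma sum_bits_prod:
  fixes f :: "nat \<Rightarrow> bool \<Rightarrow> 'a :: comm_semiring_1"
  shows "(\<Sum>x\<in>bits n. \<Prod>k<n. f k (x ! k)) = (\<Prod>k<n. \<Sum>b\<in>UNIV. f k b)"
proof (induction n arbitrary: f)
  case 0
  show ?case by (simp add: bits_0)
next
  case (Suc n)
  have "(\<Sum>x\<in>bits (Suc n). \<Prod>k<Suc n. f k (x ! k))
      = (\<Sum>(b, x)\<in>UNIV \<times> bits n. f 0 b * (\<Prod>k<n. f (Suc k) (x ! k)))"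
    unfolding bits_Suc
    by (subst sum.reindex)
       (auto simp: inj_on_def prod.lessThan_Suc_shift simp del: prod.lessThan_Suc intro!: sum.cong)
  also have "\<dots> = (\<Sum>b\<in>UNIV. f 0 b) * (\<Sum>x\<in>bits n. \<Prod>k<n. f (Suc k) (x ! k))"
    by (simp only: sum_product sum.cartesian_product)
  also have "\<dots> = (\<Prod>k<Suc n. \<Sum>b\<in>UNIV. f k b)"
    unfolding Suc.IH[of "\<lambda>k. f (Suc k)"] by (rule prod.lessThan_Suc_shift[symmetric])
  finally show ?case .
qed

lemma sum_character_eq_0:
  assumes "k < n" "v k"
  shows "(\<Sum>x\<in>bits n. \<Prod>i<n. bit_sign (v i \<and> x ! i)) = 0"
proof -
  have "(\<Sum>x\<in>bits n. \<Prod>i<n. bit_sign (v i \<and> x ! i)) = (\<Prod>i<n. \<Sum>b\<in>UNIV. bit_sign (v i \<and> b))"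
    by (rule sum_bits_prod)
  also have "\<dots> = 0"
    using assms by (intro prod_zero bexI[of _ k]) (auto simp: UNIV_bool bit_sign_def)
  finally show ?thesis .
qed

lemma prod_bit_sign_Y_string:
  assumes "S \<subseteq> {..<length r}"
  shows "(\<Prod>j\<in>S. bit_sign (Y_string r x ! j)) =
    (\<Prod>k<length x. bit_sign (row_sum S r k \<and> x ! k))"
proof -
  have "(\<Prod>j\<in>S. bit_sign (Y_string r x ! j)) =
      (\<Prod>j\<in>S. \<Prod>k<length x. bit_sign (r ! j ! k \<and> x ! k))"
    using assms by (intro prod.cong) (auto simp: Y_string_def bit_sign_inner2)
  also have "\<dots> = (\<Prod>k<length x. \<Prod>j\<in>S. bit_sign (r ! j ! k \<and> x ! k))"
    by (rule prod.swap)
  also have "\<dots> = (\<Prod>k<length x. bit_sign (row_sum S r k \<and> x ! k))"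
  proof (intro prod.cong refl)
    show "(\<Prod>j\<in>S. bit_sign (r ! j ! k \<and> x ! k)) = bit_sign (row_sum S r k \<and> x ! k)" for k
      by (cases "x ! k") (simp_all add: bit_sign_row_sum, simp add: bit_sign_def)
  qed
  finally show ?thesis .
qed


subsection \<open>Correlation with the parity\<close>

definition parity_correlation :: "nat \<Rightarrow> (bool list \<Rightarrow> real) \<Rightarrow> real" where
  "parity_correlation n f = (\<Sum>x\<in>bits n. f x * bit_sign (parity x))"

lemma parity_correlation_sum:
  "parity_correlation n (\<lambda>x. \<Sum>i\<in>I. a i * f i x) = (\<Sum>i\<in>I. a i * parity_correlation n (f i))"
  unfolding parity_correlation_def sum_distrib_right sum_distrib_left mult.assoc by (rule sum.swap)

lemma parity_correlation_character_eq_0: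
  assumes "S \<subseteq> {..<length r}" "\<not> sums_to_ones n S r"
  shows "parity_correlation n (\<lambda>x. \<Prod>j\<in>S. bit_sign (Y_string r x ! j)) = 0"
proof -
  obtain k where k: "k < n" "\<not> row_sum S r k"
    using assms(2) by (auto simp: sums_to_ones_def)
  have "(\<Prod>j\<in>S. bit_sign (Y_string r x ! j)) * bit_sign (parity x)
      = (\<Prod>i<n. bit_sign (\<not> row_sum S r i \<and> x ! i))" if "x \<in> bits n" for x
  proof -
    have "length x = n" using that by (simp add: bits_def)
    hence "(\<Prod>j\<in>S. bit_sign (Y_string r x ! j)) * bit_sign (parity x)
        = (\<Prod>i<n. bit_sign ((row_sum S r i \<and> x ! i) \<noteq> x ! i))"
      by (simp only: prod_bit_sign_Y_string[OF assms(1)] bit_sign_parity bit_sign_xor prod.distrib)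
    moreover have "((row_sum S r i \<and> x ! i) \<noteq> x ! i) = (\<not> row_sum S r i \<and> x ! i)" for i
      by auto
    ultimately show ?thesis by simp
  qed
  thus ?thesis
    unfolding parity_correlation_def using sum_character_eq_0[of k n "\<lambda>i. \<not> row_sum S r i"] k
    by simp
qed

lemma parity_correlation_monomial_eq_0:
  assumes "S \<subseteq> {..<length r}" "card S \<le> k" "\<not> ones_sum_of_at_most k n r"
  shows "parity_correlation n (\<lambda>x. \<Prod>i\<in>S. of_bool (Y_string r x ! i)) = 0"
proof -
  have "finite S" using assms(1) finite_subset by blast
  have "parity_correlation n (\<lambda>x. \<Prod>i\<in>T. bit_sign (Y_string r x ! i)) = 0" if "T \<subseteq> S" for T
  proof (rule parity_correlation_character_eq_0)
    show "T \<subseteq> {..<length r}" using that assms(1) by blast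
    moreover have "card T \<le> k" using card_mono[OF \<open>finite S\<close> that] assms(2) by simp
    ultimately show "\<not> sums_to_ones n T r" using assms(3) by (auto simp: ones_sum_of_at_most_def)
  qed
  thus ?thesis
    unfolding prod_of_bool_eq_sum_bit_signs[OF \<open>finite S\<close>] parity_correlation_sum
    by (intro sum.neutral) auto
qed

lemma parity_correlation_multilinear_eq_0:
  assumes "length r = m" "\<not> ones_sum_of_at_most k n r"
    and "\<And>S. S \<subseteq> {..<m} \<Longrightarrow> c S \<noteq> 0 \<Longrightarrow> card S \<le> k"
  shows "parity_correlation n (\<lambda>x. multilinear m c (Y_string r x)) = 0"
  unfolding multilinear_def parity_correlation_sum
  using parity_correlation_monomial_eq_0[OF _ _ assms(2)] assms(1,3) by (intro sum.neutral) auto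

lemma parity_correlation_neg:
  assumes "n > 0" and close: "\<And>x. x \<in> bits n \<Longrightarrow> \<bar>f x - of_bool (parity x)\<bar> < 1/2"
  shows "parity_correlation n f < 0"
proof -
  have "parity_correlation n f < (\<Sum>x\<in>bits n. 1/2 * bit_sign (parity x))"
    unfolding parity_correlation_def
  proof (rule sum_strict_mono[OF finite_bits])
    show "bits n \<noteq> {}"
      by (auto simp: bits_def intro: exI[of _ "replicate n True"])
    show "f x * bit_sign (parity x) < 1/2 * bit_sign (parity x)" if "x \<in> bits n" for x
      using close[OF that] unfolding abs_less_iff by (cases "parity x") (auto simp: bit_sign_def)
  qed
  also have "\<dots> = 1/2 * (\<Sum>x\<in>bits n. \<Prod>i<n. bit_sign (True \<and> x ! i))"
    unfolding sum_distrib_left by (intro sum.cong) (auto simp: bit_sign_parity bits_def)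
  also have "\<dots> = 0"
    using sum_character_eq_0[of 0 n "\<lambda>_. True"] assms(1) by simp
  finally show ?thesis .
qed

lemma cube_degree_coefficients:
  obtains c where "\<And>y. y \<in> bits m \<Longrightarrow> p y = multilinear m c y"
    "\<And>S. S \<subseteq> {..<m} \<Longrightarrow> c S \<noteq> 0 \<Longrightarrow> card S \<le> cube_degree m p"
proof -
  obtain c where "\<forall>y\<in>bits m. p y = multilinear m c y"
    using multilinear_exists by blast
  moreover have "\<forall>S\<in>Pow {..<m}. c S \<noteq> 0 \<longrightarrow> card S \<le> m"
    using card_mono[of "{..<m}"] by auto
  ultimately have "\<exists>k c. (\<forall>y\<in>bits m. p y = multilinear m c y) \<and>
      (\<forall>S\<in>Pow {..<m}. c S \<noteq> 0 \<longrightarrow> card S \<le> k)"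
    by blast
  from LeastI_ex[OF this] show ?thesis
    using that unfolding cube_degree_def[symmetric] by blast
qed


subsection \<open>Good bases\<close>

lemma good_base_templates:
  assumes "good_base n m R"
  obtains \<tau> where "\<And>j. j \<in> {n..<m} \<Longrightarrow> length (\<tau> j) = n"
    and "\<And>r. r \<in> R \<longleftrightarrow> length r = m \<and>
      (\<forall>j<m. r ! j \<in> (if j < n then {unit_string n j} else template_set (\<tau> j)))"
proof -
  obtain \<tau>s where \<tau>s: "set \<tau>s \<subseteq> bits n" "m = n + length \<tau>s"
     "R = listset (map (\<lambda>j. {unit_string n j}) [0..<n] @ map template_set \<tau>s)"
    using assms by (auto simp: good_base_def)
  show thesis
  proof (rule that[of "\<lambda>j. \<tau>s ! (j - n)"])
    fix j assume "j \<in> {n..<m}"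
    hence "\<tau>s ! (j - n) \<in> set \<tau>s" using \<tau>s(2) by (intro nth_mem) auto
    thus "length (\<tau>s ! (j - n)) = n" using \<tau>s(1) by (auto simp: bits_def)
  next
    fix r
    show "r \<in> R \<longleftrightarrow> length r = m \<and>
      (\<forall>j<m. r ! j \<in> (if j < n then {unit_string n j} else template_set (\<tau>s ! (j - n))))"
      unfolding \<tau>s(3) in_listset_iff list_all2_conv_all_nth using \<tau>s(2)
      by (auto simp: nth_append)
  qed
qed

lemma good_base_length:
  assumes "good_base n m R" "r \<in> R"
  shows "length r = m"
  by (rule good_base_templates[OF assms(1)]) (use assms(2) in blast)

lemma good_base_length_nth:
  assumes "good_base n m R" "r \<in> R" "j < m"
  shows "length (r ! j) = n"
proof -
  obtain \<tau> where "\<And>j. j \<in> {n..<m} \<Longrightarrow> length (\<tau> j) = n"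
    and "\<And>r. r \<in> R \<longleftrightarrow> length r = m \<and>
      (\<forall>j<m. r ! j \<in> (if j < n then {unit_string n j} else template_set (\<tau> j)))"
    by (rule good_base_templates[OF assms(1)]) (rule that)
  thus ?thesis
    using assms(2,3)
    by (cases "j < n") (auto simp: unit_string_def template_set_def bits_def)
qed

lemma good_base_nth_unit_string:
  assumes "good_base n m R" "r \<in> R" "j < n" "j < m"
  shows "r ! j = unit_string n j"
  by (rule good_base_templates[OF assms(1)]) (use assms(2-) in fastforce)

definition flip_bits :: "(nat \<Rightarrow> nat) \<Rightarrow> nat set \<Rightarrow> bool list list \<Rightarrow> bool list list" where
  "flip_bits g W r =
     map (\<lambda>j. map (\<lambda>k. r ! j ! k \<noteq> (k \<in> W \<and> g k = j)) [0..<length (r ! j)]) [0..<length r]"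

text \<open>A bit in a row from \<open>n\<close> on is free in \<open>R\<close> as soon as it is set in some element of \<open>R\<close>.\<close>

lemma flip_bits_in_good_base:
  assumes base: "good_base n m R" and r: "r \<in> R"
    and free: "\<And>k. k \<in> W \<Longrightarrow> n \<le> g k \<and> (\<exists>r'\<in>R. r' ! g k ! k)"
  shows "flip_bits g W r \<in> R"
proof -
  obtain \<tau> where len: "\<And>j. j \<in> {n..<m} \<Longrightarrow> length (\<tau> j) = n"
    and R: "\<And>r. r \<in> R \<longleftrightarrow> length r = m \<and>
      (\<forall>j<m. r ! j \<in> (if j < n then {unit_string n j} else template_set (\<tau> j)))"
    by (rule good_base_templates[OF base]) (rule that)
  have "flip_bits g W r ! j = unit_string n j" if "j < n" "j < m" for j
  proof -
    have "\<not> (k \<in> W \<and> g k = j)" for k using free[of k] that by auto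
    thus ?thesis
      using r that good_base_length[OF base r] good_base_nth_unit_string[OF base r]
      by (auto simp: flip_bits_def map_nth)
  qed
  moreover have "flip_bits g W r ! j \<in> template_set (\<tau> j)" if "n \<le> j" "j < m" for j
  proof -
    have row: "r' ! j \<in> template_set (\<tau> j)" if "r' \<in> R" for r'
      using that R[of r'] \<open>n \<le> j\<close> \<open>j < m\<close> by force
    have "\<tau> j ! k" if "k \<in> W" "g k = j" "k < n" for k
      using free[OF that(1)] row len[of j] \<open>n \<le> j\<close> \<open>j < m\<close> that
      by (auto simp: template_set_def)
    thus ?thesis
      using row[OF r] len[of j] that good_base_length[OF base r] good_base_length_nth[OF base r]
      by (auto simp: flip_bits_def template_set_def bits_def)
  qed
  ultimately show ?thesis
    using good_base_length[OF base r] by (simp add: R flip_bits_def)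
qed

lemma flip_bits_flip_bits: "flip_bits g W (flip_bits g W r) = r"
  by (intro nth_equalityI) (auto simp: flip_bits_def)

lemma row_sum_flip_bits:
  assumes S: "S \<subseteq> {..<length r}" and k: "\<And>j. j \<in> S \<Longrightarrow> k < length (r ! j)"
    and g: "g k \<in> S"
  shows "row_sum S (flip_bits g W r) k \<longleftrightarrow> row_sum S r k \<noteq> (k \<in> W)"
proof -
  have "finite S" using S finite_subset by blast
  have "bit_sign (row_sum S (flip_bits g W r) k) =
      (\<Prod>j\<in>S. bit_sign (r ! j ! k \<noteq> (k \<in> W \<and> g k = j)))"
    unfolding bit_sign_row_sum
    using S k by (intro prod.cong) (auto simp: flip_bits_def)
  also have "\<dots> = bit_sign (row_sum S r k) * (\<Prod>j\<in>S. if g k = j then bit_sign (k \<in> W) else 1)"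
    unfolding bit_sign_xor prod.distrib bit_sign_row_sum
    by (intro arg_cong2[of _ _ _ _ "(*)"] prod.cong) (auto simp: bit_sign_def)
  also have "\<dots> = bit_sign (row_sum S r k \<noteq> (k \<in> W))"
    using \<open>finite S\<close> g by (simp only: bit_sign_xor prod.delta' if_True)
  finally show ?thesis by simp
qed

lemma inj_on_flip_bits:
  assumes P: "P \<subseteq> {..<n}" "g ` P \<subseteq> S"
    and B: "\<And>r. r \<in> B \<Longrightarrow> sums_to_ones n S r" "\<And>r. r \<in> B \<Longrightarrow> S \<subseteq> {..<length r}"
      "\<And>r j. r \<in> B \<Longrightarrow> j \<in> S \<Longrightarrow> length (r ! j) = n"
  shows "inj_on (\<lambda>(r, W). flip_bits g W r) (B \<times> Pow P)"
proof (rule inj_on_inverseI)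
  define unset where "unset r = {k \<in> P. \<not> row_sum S r k}" for r
  have unset_flip: "unset (flip_bits g W r) = W" if "r \<in> B" "W \<subseteq> P" for r W
  proof -
    have "row_sum S (flip_bits g W r) k \<longleftrightarrow> k \<notin> W" if "k \<in> P" for k
    proof -
      have "k < n" "g k \<in> S" using P that by auto
      hence "row_sum S (flip_bits g W r) k \<longleftrightarrow> row_sum S r k \<noteq> (k \<in> W)"
        using B(2,3)[OF \<open>r \<in> B\<close>] by (intro row_sum_flip_bits) auto
      thus ?thesis using B(1)[OF \<open>r \<in> B\<close>] \<open>k < n\<close> by (simp add: sums_to_ones_def)
    qed
    thus ?thesis using that(2) by (auto simp: unset_def)
  qed
  show "(\<lambda>s. (flip_bits g (unset s) s, unset s)) ((\<lambda>(r, W). flip_bits g W r) z) = z"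
    if "z \<in> B \<times> Pow P" for z
    using that by (auto simp: unset_flip flip_bits_flip_bits)
qed


subsection \<open>Random elements of a good base\<close>

lemma sums_to_ones_free_row:
  assumes base: "good_base n m R" and r: "r \<in> R" "sums_to_ones n S r"
    and S: "S \<subseteq> {..<m}" and k: "k < n" "k \<notin> S"
  shows "\<exists>j\<in>S. n \<le> j \<and> r ! j ! k"
proof -
  have "row_sum S r k" using r(2) k(1) by (simp add: sums_to_ones_def)
  hence "\<exists>j\<in>S. r ! j ! k"
    by (rule contrapos_pp) (simp add: row_sum_def)
  then obtain j where j: "j \<in> S" "r ! j ! k" by blast
  moreover have "n \<le> j"
  proof (rule ccontr)
    assume "\<not> n \<le> j"
    hence "k = j"
      using good_base_nth_unit_string[OF base r(1)] S j k by (auto simp: unit_string_def)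
    thus False using j(1) k(2) by simp
  qed
  ultimately show ?thesis by blast
qed

text \<open>Given one \<open>r0\<close> with \<open>sums_to_ones n S r0\<close>, each position \<open>k \<notin> S\<close> has a row \<open>g k \<in> S\<close> in which
  bit \<open>k\<close> is free. Flipping these bits for the \<open>k\<close> in any set \<open>W\<close> of positions outside of \<open>S\<close> stays in
  \<open>R\<close>, and \<open>W\<close> can be read off the resulting sum.\<close>

lemma card_sums_to_ones_le:
  assumes base: "good_base n m R" and S: "S \<subseteq> {..<m}"
  shows "card {r \<in> R. sums_to_ones n S r} * 2 ^ card ({..<n} - S) \<le> card R"
proof (cases "{r \<in> R. sums_to_ones n S r} = {}")
  case True
  thus ?thesis by (simp only: card.empty)
next
  case False
  let ?ones = "{r \<in> R. sums_to_ones n S r}" and ?outside = "{..<n} - S"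
  obtain r0 where r0: "r0 \<in> R" "sums_to_ones n S r0" using False by blast
  have "\<forall>k\<in>?outside. \<exists>j. j \<in> S \<and> n \<le> j \<and> r0 ! j ! k"
    using sums_to_ones_free_row[OF base r0 S] by blast
  then obtain g where g: "\<And>k. k \<in> ?outside \<Longrightarrow> g k \<in> S" "\<And>k. k \<in> ?outside \<Longrightarrow> n \<le> g k"
      "\<And>k. k \<in> ?outside \<Longrightarrow> r0 ! g k ! k"
    by (auto dest!: bchoice)
  have "flip_bits g W r \<in> R" if "r \<in> R" "W \<subseteq> ?outside" for r W
    using that(2) g(2,3) r0(1) by (intro flip_bits_in_good_base[OF base that(1)]) blast
  hence "(\<lambda>(r, W). flip_bits g W r) ` (?ones \<times> Pow ?outside) \<subseteq> R" by auto
  moreover have "inj_on (\<lambda>(r, W). flip_bits g W r) (?ones \<times> Pow ?outside)"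
  proof (rule inj_on_flip_bits)
    show "g ` ?outside \<subseteq> S" using g(1) by blast
    show "S \<subseteq> {..<length r}" if "r \<in> ?ones" for r
      using S good_base_length[OF base] that by simp
    show "length (r ! j) = n" if "r \<in> ?ones" "j \<in> S" for r j
      using S good_base_length_nth[OF base] that by blast
  qed auto
  ultimately have "card (?ones \<times> Pow ?outside) \<le> card R"
    using good_base_finite(1)[OF base] by (intro card_inj_on_le)
  thus ?thesis by (simp add: card_cartesian_product card_Pow)
qed

lemma prob_sums_to_ones_le:
  assumes base: "good_base n m R" and S: "S \<subseteq> {..<m}"
  shows "measure_pmf.prob (pmf_of_set R) {r. sums_to_ones n S r} \<le> 2 ^ card S / 2 ^ n"
proof -
  let ?count = "card {r \<in> R. sums_to_ones n S r}"
  have "finite S" using S finite_subset by blast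
  hence "n \<le> card S + card ({..<n} - S)"
    using diff_card_le_card_Diff[of S "{..<n}"] by simp
  hence "?count * 2 ^ n \<le> ?count * 2 ^ (card S + card ({..<n} - S))"
    by (intro mult_le_mono2 power_increasing) auto
  also have "\<dots> \<le> 2 ^ card S * card R"
    using card_sums_to_ones_le[OF base S] by (simp add: power_add mult.left_commute)
  finally have "real (?count * 2 ^ n) \<le> real (2 ^ card S * card R)"
    by (simp only: of_nat_le_iff)
  moreover have "card R > 0"
    using good_base_finite[OF base] by (simp add: card_gt_0_iff)
  ultimately show ?thesis
    using good_base_finite[OF base] by (simp add: measure_pmf_of_set Int_def field_simps)
qed

lemma card_small_subsets_le:
  assumes "finite A"
  shows "card {S. S \<subseteq> A \<and> card S \<le> k} \<le> (card A + 1) ^ k"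
proof (induction k)
  case 0
  have "{S. S \<subseteq> A \<and> card S \<le> 0} = {{}}" using assms finite_subset by fastforce
  thus ?case by simp
next
  case (Suc k)
  let ?small = "\<lambda>k. {S. S \<subseteq> A \<and> card S \<le> k}"
  let ?extend = "\<lambda>(S, a). case a of None \<Rightarrow> S | Some a \<Rightarrow> insert a S"
  have "?small (Suc k) \<subseteq> ?extend ` (?small k \<times> insert None (Some ` A))"
  proof clarify
    fix S assume S: "S \<subseteq> A" "card S \<le> Suc k"
    show "S \<in> ?extend ` (?small k \<times> insert None (Some ` A))"
    proof (cases "S = {}")
      case True
      thus ?thesis by (intro image_eqI[of _ _ "({}, None)"]) auto
    next
      case False
      then obtain a where "a \<in> S" by blast
      thus ?thesis using S by (intro image_eqI[of _ _ "(S - {a}, Some a)"]) auto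
    qed
  qed
  hence "card (?small (Suc k)) \<le> card (?small k \<times> insert None (Some ` A))"
    using assms by (intro surj_card_le) auto
  also have "\<dots> = card (?small k) * (card A + 1)"
    using assms by (simp add: card_cartesian_product card_image)
  also have "\<dots> \<le> (card A + 1) ^ Suc k"
    using mult_le_mono1[OF Suc.IH, of "card A + 1"] by (simp add: mult.commute)
  finally show ?case .
qed

lemma prob_ones_sum_of_at_most_le:
  assumes base: "good_base n m R"
  shows "measure_pmf.prob (pmf_of_set R) {r. ones_sum_of_at_most k n r}
    \<le> (2 * (real m + 1)) ^ k / 2 ^ n"
proof -
  let ?small = "{S. S \<subseteq> {..<m} \<and> card S \<le> k}"
  have "finite ?small" by simp
  have "measure_pmf.prob (pmf_of_set R) {r. ones_sum_of_at_most k n r}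
      \<le> measure_pmf.prob (pmf_of_set R) (\<Union>S\<in>?small. {r. sums_to_ones n S r})"
    using good_base_finite[OF base] good_base_length[OF base]
    by (intro measure_pmf.finite_measure_mono_AE)
       (auto simp: AE_measure_pmf_iff ones_sum_of_at_most_def)
  also have "\<dots> \<le> (\<Sum>S\<in>?small. measure_pmf.prob (pmf_of_set R) {r. sums_to_ones n S r})"
    by (rule measure_UNION_le[OF \<open>finite ?small\<close>]) simp
  also have "\<dots> \<le> (\<Sum>S\<in>?small. 2 ^ k / 2 ^ n)"
  proof (rule sum_mono)
    fix S assume S: "S \<in> ?small"
    have "measure_pmf.prob (pmf_of_set R) {r. sums_to_ones n S r} \<le> 2 ^ card S / 2 ^ n"
      using S by (intro prob_sums_to_ones_le[OF base]) simp
    also have "\<dots> \<le> 2 ^ k / 2 ^ n"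
      using S by (intro divide_right_mono power_increasing) auto
    finally show "measure_pmf.prob (pmf_of_set R) {r. sums_to_ones n S r} \<le> 2 ^ k / 2 ^ n" .
  qed
  also have "\<dots> \<le> (real m + 1) ^ k * (2 ^ k / 2 ^ n)"
  proof -
    have "real (card ?small) \<le> real ((m + 1) ^ k)"
      using card_small_subsets_le[of "{..<m}" k] by (simp only: of_nat_le_iff) simp
    hence "real (card ?small) * (2 ^ k / 2 ^ n) \<le> (real m + 1) ^ k * (2 ^ k / 2 ^ n)"
      by (intro mult_right_mono) (auto simp: add.commute)
    thus ?thesis by simp
  qed
  also have "\<dots> = (2 * (real m + 1)) ^ k / 2 ^ n"
    by (simp only: power_mult_distrib) simp
  finally show ?thesis .
qed


subsection \<open>The degree lower bound\<close>

lemma PUR_inapproximable: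
  assumes base: "good_base n m R" and r: "r \<in> R" "\<not> ones_sum_of_at_most k n r"
    and deg: "cube_degree m p \<le> k" and \<epsilon>: "\<epsilon> < 1/2"
  shows "\<exists>y\<in>D_set n r. \<bar>p y - of_bool (PUR n r y)\<bar> > \<epsilon>"
proof (rule ccontr)
  assume "\<not> ?thesis"
  hence "\<bar>p (Y_string r x) - of_bool (parity x)\<bar> < 1/2" if "x \<in> bits n" for x
    using that PUR_Y_string[OF base r(1) that] \<epsilon> by (force simp: D_set_def)
  moreover have "\<not> sums_to_ones n {} r"
    using r(2) unfolding ones_sum_of_at_most_def by (metis card.empty empty_subsetI le0)
  hence "n > 0" by (auto simp: sums_to_ones_def)
  ultimately have "parity_correlation n (\<lambda>x. p (Y_string r x)) < 0"
    by (intro parity_correlation_neg)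
  moreover have "parity_correlation n (\<lambda>x. p (Y_string r x)) = 0"
  proof -
    have len: "length r = m" by (rule good_base_length[OF base r(1)])
    obtain c where p_eq: "\<And>y. y \<in> bits m \<Longrightarrow> p y = multilinear m c y"
      and card_le: "\<And>S. S \<subseteq> {..<m} \<Longrightarrow> c S \<noteq> 0 \<Longrightarrow> card S \<le> cube_degree m p"
      using cube_degree_coefficients[of m p] by blast
    have "p (Y_string r x) = multilinear m c (Y_string r x)" for x
      using len by (intro p_eq) (simp add: bits_def Y_string_def)
    thus ?thesis
      using parity_correlation_multilinear_eq_0[OF len r(2) order.trans[OF card_le deg]] by simp
  qed
  ultimately show False by simp
qed

lemma power_le_two_power_if_log2_le:
  fixes m n a :: nat
  assumes "m > 0" "real a * log 2 (real m) \<le> real n"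
  shows "m ^ a \<le> 2 ^ n"
proof (rule ccontr)
  assume "\<not> m ^ a \<le> 2 ^ n"
  hence "real n < log 2 (real (m ^ a))" by (intro less_log2_of_power) simp
  thus False using assms by (simp add: log_nat_power)
qed

lemma union_bound_le_third:
  assumes degree_le: "real k \<le> real n / (4 * log 2 (real m)) - 1"
  shows "(2 * (real m + 1)) ^ k / 2 ^ n \<le> 1/3"
proof -
  have "m \<ge> 2"
  proof (rule ccontr)
    assume "\<not> m \<ge> 2"
    \<comment> \<open>then \<open>log 2 (real m) = 0\<close>, so that the quotient is \<open>x / 0 = 0\<close>\<close>
    hence "m = 0 \<or> m = 1" by auto
    thus False using degree_le by (auto simp: log_def)
  qed
  hence "log 2 (real m) > 0" by simp
  hence "real (4 * (k + 1)) * log 2 (real m) \<le> real n"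
    using degree_le by (simp add: field_simps)
  have "2 * m \<le> m ^ 2" using \<open>m \<ge> 2\<close> by (simp add: power2_eq_square)
  hence "m + 1 \<le> m ^ 2" "3 \<le> m ^ 2" using \<open>m \<ge> 2\<close> by linarith+
  hence "3 * (2 * (m + 1)) ^ k \<le> m ^ 2 * (m * m ^ 2) ^ k"
    using \<open>m \<ge> 2\<close> by (intro mult_le_mono power_mono) auto
  also have "\<dots> = m ^ (3 * k + 2)"
    by (simp flip: power_mult power_add power_Suc add: algebra_simps)
  also have "\<dots> \<le> m ^ (4 * (k + 1))"
    using \<open>m \<ge> 2\<close> by (intro power_increasing) auto
  also have "\<dots> \<le> 2 ^ n"
    using \<open>m \<ge> 2\<close> \<open>real (4 * (k + 1)) * _ \<le> _\<close> by (intro power_le_two_power_if_log2_le) auto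
  finally have "real (3 * (2 * (m + 1)) ^ k) \<le> real (2 ^ n)"
    by (simp only: of_nat_le_iff)
  thus ?thesis by (simp add: field_simps)
qed

theorem theorem3p4:
  fixes n m :: nat and R :: "bool list list set" and d :: real
  assumes "good_base n m R"
    and "d = real n / (4 * log 2 (real m)) - 1"
  shows "measure_pmf.prob (pmf_of_set R)
    {r. \<forall>\<epsilon><1/2. \<forall>p. real (cube_degree m p) \<le> d \<longrightarrow>
          (\<exists>y\<in>D_set n r. \<bar>p y - of_bool (PUR n r y)\<bar> > \<epsilon>)} \<ge> 2/3"
    (is "measure_pmf.prob ?M ?hard \<ge> _")
proof (cases "d < 0")
  case True
  hence "?hard = UNIV" by auto
  thus ?thesis by simp
next
  case False
  define k where "k = nat \<lfloor>d\<rfloor>"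
  have "real k \<le> d" using False by (simp add: k_def)
  have "measure_pmf.prob ?M {r. ones_sum_of_at_most k n r} \<le> (2 * (real m + 1)) ^ k / 2 ^ n"
    by (rule prob_ones_sum_of_at_most_le[OF assms(1)])
  also have "\<dots> \<le> 1/3" using \<open>real k \<le> d\<close> by (intro union_bound_le_third) (simp add: assms(2))
  finally have "2/3 \<le> measure_pmf.prob ?M {r. \<not> ones_sum_of_at_most k n r}"
    using measure_pmf.prob_compl[of "{r. ones_sum_of_at_most k n r}" ?M]
    by (simp add: Collect_neg_eq Compl_eq_Diff_UNIV)
  also have "\<dots> \<le> measure_pmf.prob ?M ?hard"
    using PUR_inapproximable[OF assms(1)] good_base_finite[OF assms(1)]
    by (intro measure_pmf.finite_measure_mono_AE)
       (auto simp: AE_measure_pmf_iff k_def le_nat_floor)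
  finally show ?thesis .
qed

end
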